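(* Let $n\geq 1$, $q\geq 2$ and $s\geq 1$ be integers. For each $1\leq i\leq n$ let $A_i\subseteq \mathbb{R}$ be a subset with $|A_i|=q$, and consider the box $\mathcal{B}:=\prod_{i=1}^n A_i\subseteq \mathbb{R}^n$. Suppose that $\mathcal{F}\subseteq \mathcal{B}$ is a set such that $|d(\mathcal{F})|\leq s$. Let $d:=\frac{n(q-1)}{s}$, where $d$ is an integer with $d\geq 2$ (so that $J(q,d)$ is defined). Then $$ |\mathcal{F}|\leq 2\,(q\,J(q,d))^n . $$
   Context: For a set $\mathcal{G}\subseteq\mathbb{R}^n$, $d(\mathcal{G})$ denotes the set of non-zero Euclidean distances among points of $\mathcal{G}$: $d(\mathcal{G}):=\{d(\mathbf{p}_1,\mathbf{p}_2): \mathbf{p}_1,\mathbf{p}_2\in\mathcal{G},\ \mathbf{p}_1\neq\mathbf{p}_2\}$, where $d(\mathbf{p}_1,\mathbf{p}_2)$ is the Euclidean distance. (The number $d=\frac{n(q-1)}{s}$ in the claim is unrelated to this notation.) For integers $t,d\geq 2$, define $$ J(t,d):=\frac{1}{t}\left(\min_{0<x<1} \frac{1-x^t}{1-x}\, x^{-\frac{t-1}{d}}\right) . $$ *)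

theory Defs
  imports "HOL-Analysis.Analysis"
begin

definition dist_set :: "'a::metric_space set \<Rightarrow> real set" where
  "dist_set G = {dist p1 p2 | p1 p2. p1 \<in> G \<and> p2 \<in> G \<and> p1 \<noteq> p2}"

definition box_prod :: "('n \<Rightarrow> real set) \<Rightarrow> (real ^ 'n) set" where
  "box_prod A = {x. \<forall>i. x $ i \<in> A i}"

definition J_objective :: "nat \<Rightarrow> nat \<Rightarrow> real \<Rightarrow> real" where
  "J_objective t d x = (1 - x ^ t) / (1 - x) * x powr (- ((real t - 1) / real d))"

(* The minimum over the open interval is rendered as an infimum: for d = 2 the
   infimum, namely t, is only approached as x tends to 1 and is not attained. Whenever
   a minimiser exists the two agree (J_fun_eq_minimum). *)
definition J_fun :: "nat \<Rightarrow> nat \<Rightarrow> real" where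
  "J_fun t d = 1 / real t * (INF x\<in>{0<..<1}. J_objective t d x)"

lemma J_fun_eq_minimum:
  assumes "0 < x" "x < 1" "\<And>y. 0 < y \<Longrightarrow> y < 1 \<Longrightarrow> J_objective t d x \<le> J_objective t d y"
  shows "J_fun t d = 1 / real t * J_objective t d x"
proof -
  have "(INF y\<in>{0<..<1}. J_objective t d y) = J_objective t d x"
    by (rule cInf_eq_minimum) (use assms in auto)
  then show ?thesis
    by (simp add: J_fun_def)
qed

end

theory Submission
  imports Defs
begin

text \<open>
  The polynomial $M(x,y) = \prod_{\delta}(\|x-y\|^2-\delta^2)$, with $\delta$ ranging over the
  distances of $F$, vanishes at $(x,y) \in F \times F$ exactly when $x \neq y$, so the matrix
  $(M(x,y))_{x,y\in F}$ has rank $|F|$. On the box every monomial can be rewritten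
  with all exponents below $q$ without raising its degree. As $M$ has degree at most $2s$, each
  resulting term has degree at most $s$ in $x$ or in $y$, so the rank is at most twice the number
  of exponent vectors in $\{0,\dots,q-1\}^n$ of weight at most $s$. For $0<x<1$ this number is at
  most $x^{-s}(1+x+\dots+x^{q-1})^n$, because $x^{|\alpha|-s}\ge 1$ for the vectors counted.
\<close>

section \<open>Exponent vectors and functions on the box with reduced representations\<close>

definition exps :: "nat \<Rightarrow> nat \<Rightarrow> ('n::finite \<Rightarrow> nat) set" where
  "exps q k = {\<alpha>. (\<forall>i. \<alpha> i < q) \<and> sum \<alpha> UNIV \<le> k}"

definition monomial :: "('n::finite \<Rightarrow> nat) \<Rightarrow> real ^ 'n \<Rightarrow> real" where
  "monomial \<alpha> x = (\<Prod>i\<in>UNIV. x $ i ^ \<alpha> i)"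

text \<open>Equality is demanded only on the box. This is what permits replacing a high power of a
  coordinate by lower ones, an identity that fails on the whole space.\<close>

definition reduced_deg ::
    "('n::finite \<Rightarrow> real set) \<Rightarrow> nat \<Rightarrow> nat \<Rightarrow> (real ^ 'n \<Rightarrow> real) \<Rightarrow> bool" where
  "reduced_deg A q k f \<longleftrightarrow>
     (\<exists>c. \<forall>x\<in>box_prod A. f x = (\<Sum>\<alpha>\<in>exps q k. c \<alpha> * monomial \<alpha> x))"

text \<open>Finite sums of products \<open>f x * g y\<close> of total degree at most
  \<open>m\<close>. Generating them inductively keeps coefficients out of sight and lets closure
  properties follow by rule induction.\<close>

inductive bireduced ::
    "('n::finite \<Rightarrow> real set) \<Rightarrow> nat \<Rightarrow> nat \<Rightarrow> (real ^ 'n \<Rightarrow> real ^ 'n \<Rightarrow> real) \<Rightarrow> bool"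
  for A q where
  tensor: "reduced_deg A q k f \<Longrightarrow> reduced_deg A q l g \<Longrightarrow> k + l \<le> m \<Longrightarrow>
      bireduced A q m (\<lambda>x y. f x * g y)"
| add: "bireduced A q m h \<Longrightarrow> bireduced A q m h' \<Longrightarrow>
      bireduced A q m (\<lambda>x y. h x y + h' x y)"

section \<open>Counting exponent vectors\<close>

lemma exps_subset_PiE: "exps q k \<subseteq> (\<Pi>\<^sub>E i\<in>(UNIV :: 'n::finite set). {..<q})"
  by (auto simp: exps_def PiE_def)

lemma finite_exps [simp]: "finite (exps q k :: ('n::finite \<Rightarrow> nat) set)"
  by (rule finite_subset[OF exps_subset_PiE]) (simp add: finite_PiE)

lemma exps_mono: "k \<le> l \<Longrightarrow> exps q k \<subseteq> exps q l"
  by (auto simp: exps_def)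

lemma card_exps_le:
  fixes x :: real
  assumes "0 < x" "x < 1"
  shows "real (card (exps q s :: ('n::finite \<Rightarrow> nat) set)) \<le> (\<Sum>j<q. x ^ j) ^ CARD('n) / x ^ s"
proof -
  let ?E = "exps q s :: ('n \<Rightarrow> nat) set"
  have "real (card ?E) * x ^ s = (\<Sum>\<alpha>\<in>?E. x ^ s)"
    by simp
  also have "\<dots> \<le> (\<Sum>\<alpha>\<in>?E. x ^ sum \<alpha> UNIV)"
    using assms by (intro sum_mono power_decreasing) (auto simp: exps_def)
  also have "\<dots> \<le> (\<Sum>\<alpha>\<in>(\<Pi>\<^sub>E i\<in>(UNIV :: 'n set). {..<q}). x ^ sum \<alpha> UNIV)"
    using assms by (intro sum_mono2 exps_subset_PiE) (auto simp: finite_PiE)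
  \<comment> \<open>Expanding the product of the geometric sums chooses one exponent below
    \<open>q\<close> for each coordinate.\<close>
  also have "\<dots> = (\<Prod>i\<in>(UNIV :: 'n set). \<Sum>j<q. x ^ j)"
    by (subst prod_sum_PiE) (auto simp: power_sum)
  finally show ?thesis
    using assms by (simp add: field_simps)
qed

section \<open>Reduction of monomials on the box\<close>

lemma monomial_split:
  "monomial \<alpha> x = x $ i ^ \<alpha> i * (\<Prod>j\<in>UNIV - {i}. x $ j ^ \<alpha> j)"
  by (simp add: monomial_def prod.remove[of UNIV i])

lemma monomial_upd:
  "monomial (\<alpha>(i := k)) x = x $ i ^ k * (\<Prod>j\<in>UNIV - {i}. x $ j ^ \<alpha> j)"
  by (simp add: monomial_split[of _ _ i])

lemma sum_upd:
  fixes \<alpha> :: "'n::finite \<Rightarrow> nat"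
  shows "sum (\<alpha>(i := k)) UNIV + \<alpha> i = sum \<alpha> UNIV + k"
proof -
  have "(\<Sum>j\<in>UNIV - {i}. (\<alpha>(i := k)) j) = (\<Sum>j\<in>UNIV - {i}. \<alpha> j)"
    by (intro sum.cong) auto
  then show ?thesis
    by (simp add: sum.remove[of UNIV i])
qed

text \<open>The additive form of the weight condition avoids truncated subtraction. It covers both
  raising an exponent by one and lowering it.\<close>

lemma exps_upd:
  assumes "\<alpha> \<in> exps q k" "j < q" "k + j \<le> k' + \<alpha> i"
  shows "\<alpha>(i := j) \<in> exps q k'"
  using assms sum_upd[of \<alpha> i j] by (auto simp: exps_def)

text \<open>The monic polynomial with root set \<open>S\<close> has degree \<open>q\<close> and
  vanishes on \<open>S\<close>; solving for its leading term gives the coefficients.\<close>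

lemma power_card_as_lower_powers:
  fixes S :: "real set"
  assumes "card S = q" "finite S"
  obtains c where "\<And>t. t \<in> S \<Longrightarrow> t ^ q = (\<Sum>j<q. c j * t ^ j)"
proof -
  define p where "p = (\<Prod>a\<in>S. [:- a, 1:])"
  have "degree p = q"
    using assms by (simp add: p_def degree_prod_sum_eq)
  moreover have "lead_coeff p = 1"
    unfolding p_def lead_coeff_prod by simp
  ultimately have p: "degree p = q" "coeff p q = 1"
    by auto
  show thesis
  proof (rule that[of "\<lambda>j. - coeff p j"])
    fix t assume "t \<in> S"
    then have "poly p t = 0"
      using assms by (auto simp: p_def poly_prod prod_zero_iff)
    then show "t ^ q = (\<Sum>j<q. - coeff p j * t ^ j)"
      using p by (simp add: poly_altdef lessThan_Suc_atMost[symmetric] sum_negf)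
  qed
qed

lemma reduced_deg_cong:
  "(\<And>x. x \<in> box_prod A \<Longrightarrow> f x = g x) \<Longrightarrow> reduced_deg A q k f \<longleftrightarrow> reduced_deg A q k g"
  by (simp add: reduced_deg_def)

lemma reduced_deg_monomial:
  assumes "\<alpha> \<in> exps q k"
  shows "reduced_deg A q k (monomial \<alpha>)"
  unfolding reduced_deg_def
proof (intro exI[of _ "\<lambda>\<beta>. if \<beta> = \<alpha> then 1 else 0"] ballI)
  fix x
  show "monomial \<alpha> x = (\<Sum>\<beta>\<in>exps q k. (if \<beta> = \<alpha> then 1 else 0) * monomial \<beta> x)"
    using assms by (simp add: if_distrib[of "\<lambda>c. c * _"] cong: if_cong)
qed

lemma reduced_deg_add:
  assumes "reduced_deg A q k f" "reduced_deg A q k g"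
  shows "reduced_deg A q k (\<lambda>x. f x + g x)"
proof -
  obtain c c' where
    "\<forall>x\<in>box_prod A. f x = (\<Sum>\<alpha>\<in>exps q k. c \<alpha> * monomial \<alpha> x)"
    "\<forall>x\<in>box_prod A. g x = (\<Sum>\<alpha>\<in>exps q k. c' \<alpha> * monomial \<alpha> x)"
    using assms unfolding reduced_deg_def by blast
  then show ?thesis
    unfolding reduced_deg_def
    by (intro exI[of _ "\<lambda>\<alpha>. c \<alpha> + c' \<alpha>"]) (simp add: distrib_right sum.distrib)
qed

lemma reduced_deg_scale:
  assumes "reduced_deg A q k f"
  shows "reduced_deg A q k (\<lambda>x. r * f x)"
proof -
  obtain c where "\<forall>x\<in>box_prod A. f x = (\<Sum>\<alpha>\<in>exps q k. c \<alpha> * monomial \<alpha> x)"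
    using assms unfolding reduced_deg_def by blast
  then show ?thesis
    unfolding reduced_deg_def
    by (intro exI[of _ "\<lambda>\<alpha>. r * c \<alpha>"]) (simp add: sum_distrib_left mult.assoc)
qed

lemma reduced_deg_sum:
  assumes "finite I" "\<And>i. i \<in> I \<Longrightarrow> reduced_deg A q k (f i)"
  shows "reduced_deg A q k (\<lambda>x. \<Sum>i\<in>I. f i x)"
  using assms
proof (induction I)
  case empty
  show ?case
    by (simp add: reduced_deg_def exI[of _ "\<lambda>_. 0"])
next
  case (insert i I)
  then show ?case
    by (simp add: reduced_deg_add)
qed

lemma reduced_deg_const:
  assumes "0 < q"
  shows "reduced_deg A q k (\<lambda>x. r)"
proof -
  have "reduced_deg A q k (\<lambda>x. r * monomial (\<lambda>_. 0) x)"
    using assms by (intro reduced_deg_scale reduced_deg_monomial) (simp add: exps_def)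
  then show ?thesis
    by (simp add: monomial_def)
qed

text \<open>On each monomial, either the exponent of coordinate \<open>i\<close> can grow and stay
  below \<open>q\<close>, or it equals \<open>q - 1\<close> and the resulting \<open>q\<close>-th
  power is rewritten through lower powers valid on \<open>A i\<close>.\<close>

lemma reduced_deg_mult_coord:
  fixes A :: "'n::finite \<Rightarrow> real set"
  assumes "card (A i) = q" "finite (A i)" "reduced_deg A q k f"
  shows "reduced_deg A q (Suc k) (\<lambda>x. x $ i * f x)"
proof -
  obtain c where c: "\<forall>x\<in>box_prod A. f x = (\<Sum>\<alpha>\<in>exps q k. c \<alpha> * monomial \<alpha> x)"
    using assms unfolding reduced_deg_def by blast
  obtain b where b: "\<And>t. t \<in> A i \<Longrightarrow> t ^ q = (\<Sum>j<q. b j * t ^ j)"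
    using power_card_as_lower_powers assms by metis
  have "reduced_deg A q (Suc k) (\<lambda>x. x $ i * monomial \<alpha> x)" if \<alpha>: "\<alpha> \<in> exps q k" for \<alpha>
  proof (cases "Suc (\<alpha> i) < q")
    case True
    have "reduced_deg A q (Suc k) (monomial (\<alpha>(i := Suc (\<alpha> i))))"
      using True by (intro reduced_deg_monomial exps_upd[OF \<alpha>]) auto
    then show ?thesis
      by (simp add: monomial_upd monomial_split[of \<alpha> _ i] mult.assoc cong: reduced_deg_cong)
  next
    case False
    moreover have "\<alpha> i < q"
      using \<alpha> by (simp add: exps_def)
    ultimately have q: "q = Suc (\<alpha> i)"
      by linarith
    \<comment> \<open>The exponent of coordinate \<open>i\<close> was \<open>q - 1\<close>, so
      putting any \<open>j < q\<close> in its place does not increase the weight.\<close>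
    have "reduced_deg A q (Suc k) (\<lambda>x. \<Sum>j<q. b j * monomial (\<alpha>(i := j)) x)"
      using q
      by (intro reduced_deg_sum reduced_deg_scale reduced_deg_monomial exps_upd[OF \<alpha>])
        auto
    moreover have "(\<Sum>j<q. b j * monomial (\<alpha>(i := j)) x) = x $ i * monomial \<alpha> x"
      if "x \<in> box_prod A" for x
    proof -
      have "(\<Sum>j<q. b j * monomial (\<alpha>(i := j)) x)
          = (\<Sum>j<q. b j * x $ i ^ j) * (\<Prod>j\<in>UNIV - {i}. x $ j ^ \<alpha> j)"
        by (simp add: monomial_upd sum_distrib_right mult.assoc)
      also have "\<dots> = x $ i ^ q * (\<Prod>j\<in>UNIV - {i}. x $ j ^ \<alpha> j)"
        using b[of "x $ i"] that by (simp add: box_prod_def)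
      also have "\<dots> = x $ i * monomial \<alpha> x"
        by (simp add: monomial_split[of \<alpha> _ i] q mult.assoc)
      finally show ?thesis .
    qed
    ultimately show ?thesis
      by (simp cong: reduced_deg_cong)
  qed
  then have "reduced_deg A q (Suc k) (\<lambda>x. \<Sum>\<alpha>\<in>exps q k. c \<alpha> * (x $ i * monomial \<alpha> x))"
    by (intro reduced_deg_sum reduced_deg_scale) auto
  moreover have "(\<Sum>\<alpha>\<in>exps q k. c \<alpha> * (x $ i * monomial \<alpha> x)) = x $ i * f x"
    if "x \<in> box_prod A" for x
    using c that by (simp add: sum_distrib_left mult.left_commute)
  ultimately show ?thesis
    by (simp cong: reduced_deg_cong)
qed

section \<open>Closure properties of two-variable reduced functions\<close>

lemma bireduced_const:
  assumes "0 < q"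
  shows "bireduced A q m (\<lambda>x y. r)"
  using tensor[OF reduced_deg_const reduced_deg_const, of q 0 0 m A r 1] assms by simp

lemma bireduced_scale:
  assumes "bireduced A q m h"
  shows "bireduced A q m (\<lambda>x y. r * h x y)"
  using assms
proof induction
  case (tensor k f l g m)
  then show ?case
    using bireduced.tensor[OF reduced_deg_scale] by (simp add: mult.assoc[symmetric])
next
  case (add m h h')
  then show ?case
    using bireduced.add by (simp add: distrib_left)
qed

lemma bireduced_mono:
  assumes "bireduced A q m h" "m \<le> m'"
  shows "bireduced A q m' h"
  using assms by induction (auto intro: bireduced.intros)

lemma bireduced_sum:
  assumes "0 < q" "finite I" "\<And>i. i \<in> I \<Longrightarrow> bireduced A q m (h i)"
  shows "bireduced A q m (\<lambda>x y. \<Sum>i\<in>I. h i x y)"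
  using assms(2,3) by (induction I) (simp_all add: bireduced_const assms(1) add)

lemma bireduced_mult_coord1:
  assumes "card (A i) = q" "finite (A i)" "bireduced A q m h"
  shows "bireduced A q (Suc m) (\<lambda>x y. x $ i * h x y)"
  using assms(3)
proof induction
  case (tensor k f l g m)
  then show ?case
    using bireduced.tensor[OF reduced_deg_mult_coord[where A = A and q = q], of i k f l g "Suc m"]
      assms by (simp add: mult.assoc[symmetric])
next
  case (add m h h')
  then show ?case
    using bireduced.add by (simp add: distrib_left)
qed

lemma bireduced_mult_coord2:
  assumes "card (A i) = q" "finite (A i)" "bireduced A q m h"
  shows "bireduced A q (Suc m) (\<lambda>x y. y $ i * h x y)"
  using assms(3)
proof induction
  case (tensor k f l g m)
  then show ?case
    using bireduced.tensor[OF _ reduced_deg_mult_coord[where A = A and q = q], of k f i l g "Suc m"]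
      assms by (simp add: mult.left_commute)
next
  case (add m h h')
  then show ?case
    using bireduced.add by (simp add: distrib_left)
qed

text \<open>The squared distance is the sum of \<open>x_i^2 - 2 x_i y_i + y_i^2\<close>, so each of
  its terms multiplies by two coordinates and costs degree 2, while the constant \<open>r\<close>
  costs none.\<close>

lemma bireduced_mult_sqdist:
  fixes A :: "'n::finite \<Rightarrow> real set"
  assumes "0 < q" "\<And>i. card (A i) = q" "bireduced A q m h"
  shows "bireduced A q (m + 2) (\<lambda>x y. ((dist x y)\<^sup>2 - r) * h x y)"
proof -
  \<comment> \<open>Infinite sets have \<open>card\<close> 0, so a positive cardinality forces
    finiteness.\<close>
  have fin: "finite (A i)" for i
    using assms(1) assms(2)[of i] card_ge_0_finite by metis
  note coord1 = bireduced_mult_coord1[OF assms(2) fin]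
  note coord2 = bireduced_mult_coord2[OF assms(2) fin]
  have "bireduced A q (m + 2) (\<lambda>x y. (\<Sum>i\<in>UNIV. x $ i * (x $ i * h x y)
      + ((-2) * (x $ i * (y $ i * h x y)) + y $ i * (y $ i * h x y))) + (- r) * h x y)"
    unfolding add_2_eq_Suc'
    using bireduced_mono[OF assms(3), of "Suc (Suc m)"]
    by (intro add bireduced_sum bireduced_scale coord1 coord2 assms) auto
  moreover have "((dist x y)\<^sup>2 - r) * h x y = (\<Sum>i\<in>UNIV. x $ i * (x $ i * h x y)
      + ((-2) * (x $ i * (y $ i * h x y)) + y $ i * (y $ i * h x y))) + (- r) * h x y"
    for x y :: "real ^ 'n"
  proof -
    have "(dist x y)\<^sup>2 = (\<Sum>i\<in>UNIV. (x $ i - y $ i)\<^sup>2)"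
      by (simp add: dist_vec_def L2_set_def dist_real_def sum_nonneg)
    then have "(dist x y)\<^sup>2 * h x y = (\<Sum>i\<in>UNIV. x $ i * (x $ i * h x y)
        + ((-2) * (x $ i * (y $ i * h x y)) + y $ i * (y $ i * h x y)))"
      by (simp only: sum_distrib_right)
        (intro sum.cong refl, simp add: power2_eq_square algebra_simps)
    then show ?thesis
      by (simp add: left_diff_distrib)
  qed
  ultimately show ?thesis
    by simp
qed

lemma bireduced_prod_sqdist:
  fixes A :: "'n::finite \<Rightarrow> real set"
  assumes "0 < q" "\<And>i. card (A i) = q" "finite D"
  shows "bireduced A q (2 * card D) (\<lambda>x y. \<Prod>\<delta>\<in>D. (dist x y)\<^sup>2 - \<delta>\<^sup>2)"
  using assms(3)
proof (induction D)
  case empty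
  show ?case
    using bireduced_const[OF assms(1)] by simp
next
  case (insert \<delta> D)
  then show ?case
    using bireduced_mult_sqdist[OF assms(1,2) insert.IH, of "\<delta>\<^sup>2"] by simp
qed

section \<open>Decomposition into few rank-one terms\<close>

lemma reduced_deg_mono:
  assumes "reduced_deg A q k f" "k \<le> l"
  shows "reduced_deg A q l f"
proof -
  obtain c where c: "\<forall>x\<in>box_prod A. f x = (\<Sum>\<alpha>\<in>exps q k. c \<alpha> * monomial \<alpha> x)"
    using assms unfolding reduced_deg_def by blast
  have "reduced_deg A q l (\<lambda>x. \<Sum>\<alpha>\<in>exps q k. c \<alpha> * monomial \<alpha> x)"
    using exps_mono[OF assms(2)]
    by (intro reduced_deg_sum reduced_deg_scale reduced_deg_monomial) auto
  then show ?thesis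
    using c by (simp cong: reduced_deg_cong)
qed

text \<open>From \<open>k + l \<le> 2 * s\<close>, one factor of each product has degree at most
  \<open>s\<close>. That factor is expanded in monomials and the other is absorbed into
  \<open>u\<close> or \<open>v\<close>, about which nothing need be known: only the number of terms
  bounds the rank.\<close>

lemma bireduced_low_rank:
  assumes "bireduced A q (2 * s) h"
  shows "\<exists>u v. \<forall>x\<in>box_prod A. \<forall>y\<in>box_prod A.
    h x y = (\<Sum>\<alpha>\<in>exps q s. monomial \<alpha> x * u \<alpha> y) + (\<Sum>\<alpha>\<in>exps q s. v \<alpha> x * monomial \<alpha> y)"
  using assms
proof (induction "2 * s" h)
  case (tensor k f l g)
  then consider "k \<le> s" | "l \<le> s"
    by linarith
  then show ?case
  proof cases
    case 1
    then have "reduced_deg A q s f"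
      using tensor reduced_deg_mono by blast
    then obtain c where "\<forall>x\<in>box_prod A. f x = (\<Sum>\<alpha>\<in>exps q s. c \<alpha> * monomial \<alpha> x)"
      unfolding reduced_deg_def by blast
    then show ?thesis
      by (intro exI[of _ "\<lambda>\<alpha> y. c \<alpha> * g y"] exI[of _ "\<lambda>\<alpha> x. 0"])
        (simp add: sum_distrib_left sum_distrib_right mult_ac)
  next
    case 2
    then have "reduced_deg A q s g"
      using tensor reduced_deg_mono by blast
    then obtain c where "\<forall>x\<in>box_prod A. g x = (\<Sum>\<alpha>\<in>exps q s. c \<alpha> * monomial \<alpha> x)"
      unfolding reduced_deg_def by blast
    then show ?thesis
      by (intro exI[of _ "\<lambda>\<alpha> y. 0"] exI[of _ "\<lambda>\<alpha> x. c \<alpha> * f x"])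
        (simp add: sum_distrib_left sum_distrib_right mult_ac)
  qed
next
  case (add h h')
  then obtain u v u' v' where
    "\<forall>x\<in>box_prod A. \<forall>y\<in>box_prod A. h x y
      = (\<Sum>\<alpha>\<in>exps q s. monomial \<alpha> x * u \<alpha> y) + (\<Sum>\<alpha>\<in>exps q s. v \<alpha> x * monomial \<alpha> y)"
    "\<forall>x\<in>box_prod A. \<forall>y\<in>box_prod A. h' x y
      = (\<Sum>\<alpha>\<in>exps q s. monomial \<alpha> x * u' \<alpha> y) + (\<Sum>\<alpha>\<in>exps q s. v' \<alpha> x * monomial \<alpha> y)"
    by blast
  then show ?case
    by (intro exI[of _ "\<lambda>\<alpha> y. u \<alpha> y + u' \<alpha> y"] exI[of _ "\<lambda>\<alpha> x. v \<alpha> x + v' \<alpha> x"])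
      (simp add: distrib_left distrib_right sum.distrib)
qed

section \<open>Linear algebra: homogeneous systems with fewer equations than unknowns\<close>

lemma homogeneous_system_nontrivial_solution:
  fixes \<phi> :: "'i \<Rightarrow> 'a \<Rightarrow> real"
  assumes "finite I" "finite F" "card I < card F"
  shows "\<exists>c. (\<exists>y\<in>F. c y \<noteq> 0) \<and> (\<forall>i\<in>I. (\<Sum>y\<in>F. c y * \<phi> i y) = 0)"
  using assms
proof (induction I arbitrary: F \<phi>)
  case empty
  then obtain y where "y \<in> F"
    by fastforce
  then show ?case
    by (intro exI[of _ "\<lambda>_. 1"]) auto
next
  case (insert i I)
  show ?case
  proof (cases "\<forall>y\<in>F. \<phi> i y = 0")
    case True
    have "card I < card F"
      using insert by simp
    then show ?thesis
      using insert.IH[OF insert.prems(1), of \<phi>] True by auto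
  next
    case False
    \<comment> \<open>Gaussian elimination with pivot \<open>\<phi> i z\<close>: equation
      \<open>i\<close> expresses the unknown at \<open>z\<close> through the others, and
      substituting this into equation \<open>j\<close> gives the coefficients passed to the
      induction hypothesis.\<close>
    then obtain z where z: "z \<in> F" "\<phi> i z \<noteq> 0"
      by blast
    let ?G = "F - {z}"
    have "card I < card ?G" "finite ?G"
      using insert z by simp_all
    from insert.IH[OF this(2,1), of "\<lambda>j y. \<phi> j y - \<phi> j z * \<phi> i y / \<phi> i z"]
    obtain c where c: "\<exists>y\<in>?G. c y \<noteq> 0"
      and eq: "\<And>j. j \<in> I \<Longrightarrow> (\<Sum>y\<in>?G. c y * (\<phi> j y - \<phi> j z * \<phi> i y / \<phi> i z)) = 0"
      by blast
    \<comment> \<open>Back substitution: the value at \<open>z\<close> is the one forced by equation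
      \<open>i\<close>.\<close>
    define c' where "c' = c(z := - (\<Sum>y\<in>?G. c y * \<phi> i y) / \<phi> i z)"
    have *: "(\<Sum>y\<in>F. c' y * \<phi> j y) = c' z * \<phi> j z + (\<Sum>y\<in>?G. c y * \<phi> j y)" for j
      using z insert.prems by (simp add: sum.remove[of F z] c'_def)
    have "(\<Sum>y\<in>F. c' y * \<phi> j y) = 0" if "j \<in> I" for j
    proof -
      have "(\<Sum>y\<in>?G. c y * \<phi> j y) = (\<phi> j z / \<phi> i z) * (\<Sum>y\<in>?G. c y * \<phi> i y)"
        using eq[OF that] by (simp add: right_diff_distrib sum_subtractf sum_distrib_left mult_ac)
      then show ?thesis
        unfolding * by (simp add: c'_def)
    qed
    moreover have "(\<Sum>y\<in>F. c' y * \<phi> i y) = 0"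
      unfolding * using z by (simp add: c'_def)
    moreover have "\<exists>y\<in>F. c' y \<noteq> 0"
      using c by (auto simp: c'_def)
    ultimately show ?thesis
      by blast
  qed
qed

section \<open>Finiteness and the rank bound on \<open>F\<close>\<close>

lemma finite_box_prod:
  fixes A :: "'n::finite \<Rightarrow> real set"
  assumes "\<And>i. finite (A i)"
  shows "finite (box_prod A)"
proof (rule finite_imageD)
  show "finite (vec_nth ` box_prod A)"
    by (rule finite_subset[of _ "\<Pi>\<^sub>E i\<in>UNIV. A i"])
      (use assms in \<open>auto simp: box_prod_def finite_PiE\<close>)
  show "inj_on vec_nth (box_prod A)"
    by (simp add: inj_on_def vec_nth_inject)
qed

lemma finite_dist_set:
  assumes "finite F"
  shows "finite (dist_set F)"
  by (rule finite_subset[of _ "(\<lambda>(x, y). dist x y) ` (F \<times> F)"])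
    (use assms in \<open>auto simp: dist_set_def\<close>)

text \<open>The rank comparison is carried out with a kernel vector. If \<open>F\<close> were
  larger, some nonzero \<open>c\<close> would be orthogonal on \<open>F\<close> to every
  \<open>u \<alpha>\<close> and every monomial, hence annihilated by the matrix \<open>M\<close>;
  but \<open>M\<close> is diagonal on \<open>F\<close> with nonzero diagonal entries.\<close>

lemma card_le_exps:
  fixes A :: "'n::finite \<Rightarrow> real set"
  assumes "0 < q" "\<And>i. card (A i) = q" "F \<subseteq> box_prod A" "card (dist_set F) \<le> s"
  shows "card F \<le> 2 * card (exps q s :: ('n \<Rightarrow> nat) set)"
proof (rule ccontr)
  let ?E = "exps q s :: ('n \<Rightarrow> nat) set"
  assume less: "\<not> card F \<le> 2 * card ?E"
  \<comment> \<open>An infinite \<open>F\<close> would have \<open>card F = 0\<close> and satisfy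
    the bound.\<close>
  have finF: "finite F"
    using less card.infinite by fastforce
  define M where "M x y = (\<Prod>\<delta>\<in>dist_set F. (dist x y)\<^sup>2 - \<delta>\<^sup>2)" for x y :: "real ^ 'n"
  have "bireduced A q (2 * s) M"
    unfolding M_def
    by (rule bireduced_mono[OF bireduced_prod_sqdist]) (use assms finF finite_dist_set in auto)
  from bireduced_low_rank[OF this] obtain u v where M:
    "\<And>x y. x \<in> F \<Longrightarrow> y \<in> F \<Longrightarrow>
      M x y = (\<Sum>\<alpha>\<in>?E. monomial \<alpha> x * u \<alpha> y) + (\<Sum>\<alpha>\<in>?E. v \<alpha> x * monomial \<alpha> y)"
    using assms(3) by blast
  \<comment> \<open>The disjoint sum indexes both families of equations at once: the left copy for
    the functions \<open>u \<alpha>\<close>, the right copy for the monomials.\<close>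
  have "card (?E <+> ?E) < card F"
    using less by (simp add: card_Plus)
  from homogeneous_system_nontrivial_solution[OF _ finF this, of "case_sum u monomial"]
  obtain c z where z: "z \<in> F" "c z \<noteq> 0"
    and c: "\<And>i. i \<in> ?E <+> ?E \<Longrightarrow> (\<Sum>y\<in>F. c y * case_sum u monomial i y) = 0"
    by auto
  have c1: "(\<Sum>y\<in>F. c y * u \<alpha> y) = 0" and c2: "(\<Sum>y\<in>F. c y * monomial \<alpha> y) = 0"
    if "\<alpha> \<in> ?E" for \<alpha>
    using c[of "Inl \<alpha>"] c[of "Inr \<alpha>"] that by auto
  have "(\<Sum>y\<in>F. c y * M z y)
      = (\<Sum>y\<in>F. (\<Sum>\<alpha>\<in>?E. monomial \<alpha> z * (c y * u \<alpha> y)) + (\<Sum>\<alpha>\<in>?E. v \<alpha> z * (c y * monomial \<alpha> y)))"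
    using z by (intro sum.cong) (simp_all add: M distrib_left sum_distrib_left mult_ac)
  also have "\<dots> = (\<Sum>\<alpha>\<in>?E. monomial \<alpha> z * (\<Sum>y\<in>F. c y * u \<alpha> y))
      + (\<Sum>\<alpha>\<in>?E. v \<alpha> z * (\<Sum>y\<in>F. c y * monomial \<alpha> y))"
    by (simp add: sum.distrib sum_distrib_left) (simp add: sum.swap[of _ F])
  also have "\<dots> = 0"
    by (simp add: c1 c2)
  finally have "(\<Sum>y\<in>F. c y * M z y) = 0" .
  \<comment> \<open>The distance from \<open>z\<close> to \<open>y\<close> is itself one of the
    \<open>\<delta>\<close>, so a factor vanishes.\<close>
  moreover have "M z y = 0" if "y \<in> F - {z}" for y
    using that z finite_dist_set[OF finF]
    by (auto simp: M_def dist_set_def prod_zero_iff)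
  ultimately have "c z * M z z = 0"
    using z finF by (simp add: sum.remove[of F z])
  \<comment> \<open>Each factor is \<open>-\<delta>^2\<close> with \<open>\<delta>\<close> a
    distance between distinct points, hence nonzero.\<close>
  moreover have "M z z \<noteq> 0"
    using finite_dist_set[OF finF] by (auto simp: M_def dist_set_def)
  ultimately show False
    using z by simp
qed

section \<open>Passage from the count to \<open>J_fun\<close>\<close>

theorem corollary1p5:
  fixes A :: "'n::finite \<Rightarrow> real set"
    and F :: "(real ^ 'n) set"
    and q s d :: nat
  assumes "q \<ge> 2" and "s \<ge> 1"
    and "\<And>i. card (A i) = q"
    and "F \<subseteq> box_prod A"
    and "card (dist_set F) \<le> s"
    and "real d = real CARD('n) * (real q - 1) / real s"
    and "d \<ge> 2"
  shows "real (card F) \<le> 2 * (real q * J_fun q d) ^ CARD('n)"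
proof -
  let ?n = "CARD('n)"
  \<comment> \<open>Taking the root first turns the bound at each \<open>x\<close> into a lower
    bound for the objective itself, which can then pass to the infimum.\<close>
  let ?r = "root ?n (real (card F) / 2)"
  have n: "0 < ?n"
    by simp
  have "?r \<le> J_objective q d x" if "x \<in> {0<..<1}" for x
  proof -
    have x: "0 < x" "x < 1"
      using that by auto
    have geo: "(1 - x ^ q) / (1 - x) = (\<Sum>j<q. x ^ j)"
      using x by (simp add: sum_gp_strict)
    \<comment> \<open>The choice of \<open>d\<close> is made for this: the \<open>n\<close>-th power
      of the \<open>powr\<close> factor becomes exactly \<open>x^-s\<close>, matching the counting
      bound.\<close>
    have "(real q - 1) / real d * real ?n = real s"
      using assms(1,2,6,7) by (simp add: field_simps)
    then have "(x powr (- ((real q - 1) / real d))) ^ ?n = x powr (- real s)"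
      using x by (simp add: powr_realpow[symmetric] powr_powr)
    also have "\<dots> = 1 / x ^ s"
      using x by (simp add: powr_minus_divide powr_realpow)
    finally have obj: "J_objective q d x ^ ?n = (\<Sum>j<q. x ^ j) ^ ?n / x ^ s"
      by (simp add: J_objective_def geo power_mult_distrib)
    have "real (card F) \<le> 2 * real (card (exps q s :: ('n \<Rightarrow> nat) set))"
      using card_le_exps[of q A F s] assms by simp
    also have "\<dots> \<le> 2 * J_objective q d x ^ ?n"
      using card_exps_le[OF x, of q s, where 'n = 'n] obj by simp
    finally have "real (card F) / 2 \<le> J_objective q d x ^ ?n"
      by simp
    then have "?r \<le> root ?n (J_objective q d x ^ ?n)"
      by simp
    also have "\<dots> = J_objective q d x"
      using x by (intro real_root_power_cancel) (auto simp: J_objective_def geo sum_nonneg)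
    finally show ?thesis .
  qed
  \<comment> \<open>A lower bound at every point of the interval passes to the infimum, attained or
    not.\<close>
  then have "?r \<le> (INF x\<in>{0<..<1}. J_objective q d x)"
    by (intro cINF_greatest) auto
  also have "\<dots> = real q * J_fun q d"
    using assms(1) by (simp add: J_fun_def)
  finally have "?r ^ ?n \<le> (real q * J_fun q d) ^ ?n"
    by (intro power_mono) auto
  then show ?thesis
    by (simp add: real_root_pow_pos2)
qed

end
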